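(* Let $R$ be a $P$-symmetric ring. Then $N_2(R)=\{a\in R \mid a^2=0\}\subseteq P(R)$. In particular, $R$ is $P$-semicommutative.
   Context: Rings are associative with identity (not necessarily commutative). $P(R)$ denotes the prime radical of a ring $R$ (the intersection of all prime two-sided ideals of $R$). A ring $R$ is $P$-symmetric if for any $a,b,c\in R$, $abc=0$ implies $bac\in P(R)$. A ring $R$ is $P$-semicommutative if for any $a,b\in R$, $ab=0$ implies $aRb\subseteq P(R)$. *)

theory Defs
  imports "HOL-Algebra.Ideal_Product"
begin

(* The library locale primeideal presupposes a commutative ring and uses the elementwise
   (completely prime) condition, so the two-sided notion for general rings is defined here. *)
definition two_sided_prime_ideal :: "'a set \<Rightarrow> ('a, 'b) ring_scheme \<Rightarrow> bool" where
  "two_sided_prime_ideal P R \<longleftrightarrow>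
     ideal P R \<and> P \<noteq> carrier R \<and>
     (\<forall>I J. ideal I R \<longrightarrow> ideal J R \<longrightarrow> ideal_prod R I J \<subseteq> P \<longrightarrow> I \<subseteq> P \<or> J \<subseteq> P)"

(* The intersection is taken inside carrier R; in the zero ring, which has no prime ideals,
   this gives the whole ring. *)
definition prime_radical :: "('a, 'b) ring_scheme \<Rightarrow> 'a set" where
  "prime_radical R = carrier R \<inter> \<Inter>{P. two_sided_prime_ideal P R}"

definition P_symmetric :: "('a, 'b) ring_scheme \<Rightarrow> bool" where
  "P_symmetric R \<longleftrightarrow>
     (\<forall>a \<in> carrier R. \<forall>b \<in> carrier R. \<forall>c \<in> carrier R.
        a \<otimes>\<^bsub>R\<^esub> b \<otimes>\<^bsub>R\<^esub> c = \<zero>\<^bsub>R\<^esub> \<longrightarrow> b \<otimes>\<^bsub>R\<^esub> a \<otimes>\<^bsub>R\<^esub> c \<in> prime_radical R)"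

definition P_semicommutative :: "('a, 'b) ring_scheme \<Rightarrow> bool" where
  "P_semicommutative R \<longleftrightarrow>
     (\<forall>a \<in> carrier R. \<forall>b \<in> carrier R.
        a \<otimes>\<^bsub>R\<^esub> b = \<zero>\<^bsub>R\<^esub> \<longrightarrow> {a \<otimes>\<^bsub>R\<^esub> r \<otimes>\<^bsub>R\<^esub> b | r. r \<in> carrier R} \<subseteq> prime_radical R)"

definition N2 :: "('a, 'b) ring_scheme \<Rightarrow> 'a set" where
  "N2 R = {a \<in> carrier R. a [^]\<^bsub>R\<^esub> (2::nat) = \<zero>\<^bsub>R\<^esub>}"

end

theory Submission
  imports Defs
begin

text \<open>
  If \<open>a b = 0\<close>, then \<open>r a b = 0\<close> for every \<open>r\<close>, and \<open>P\<close>-symmetry exchanges the first two factors: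
  \<open>a r b\<close> lies in the prime radical. For \<open>a = b\<close> this says \<open>a R a \<subseteq> P\<close> for every prime ideal \<open>P\<close>,
  whence \<open>a \<in> P\<close>.
\<close>

text \<open>The free middle factor \<open>r\<close> makes the set two-sided: a left multiplier
  \<open>s\<close> of \<open>x\<close> is absorbed into \<open>r\<close>, while a right multiplier
  is absorbed by \<open>P\<close>.\<close>

lemma (in ring) ideal_right_annihilator_mod:
  assumes "ideal P R" and a: "a \<in> carrier R"
  shows "ideal {x \<in> carrier R. \<forall>r \<in> carrier R. a \<otimes> r \<otimes> x \<in> P} R" (is "ideal ?J R")
proof -
  interpret P: ideal P R by fact
  show ?thesis
  proof (rule idealI[OF ring_axioms])
    show "subgroup ?J (add_monoid R)"
    proof (rule add.subgroupI)
      fix x assume "x \<in> ?J"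
      then show "\<ominus> x \<in> ?J" using a by (simp add: r_minus P.a_inv_closed)
    next
      show "?J \<noteq> {}" using a P.zero_closed by (auto intro: exI[of _ \<zero>])
    qed (use a in \<open>auto simp: r_distr P.a_closed\<close>)
  next
    fix x s assume x: "x \<in> ?J" and s: "s \<in> carrier R"
    have "a \<otimes> r \<otimes> (s \<otimes> x) = a \<otimes> (r \<otimes> s) \<otimes> x" if "r \<in> carrier R" for r
      using x s a that by (simp add: m_assoc)
    then show "s \<otimes> x \<in> ?J" using x s by simp
    have "a \<otimes> r \<otimes> (x \<otimes> s) = a \<otimes> r \<otimes> x \<otimes> s" if "r \<in> carrier R" for r
      using x s a that by (simp add: m_assoc)
    then show "x \<otimes> s \<in> ?J" using x s by (simp add: P.I_r_closed)
  qed
qed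

text \<open>A left multiplier is absorbed by \<open>P\<close>; a right multiplier \<open>s\<close>
  of \<open>y\<close> moves over to \<open>x\<close>, and \<open>s \<otimes> x\<close> stays in
  \<open>J\<close>.\<close>

lemma (in ring) ideal_left_annihilator_mod:
  assumes "ideal P R" and "ideal J R"
  shows "ideal {y \<in> carrier R. \<forall>x \<in> J. y \<otimes> x \<in> P} R" (is "ideal ?I R")
proof -
  interpret P: ideal P R by fact
  interpret J: ideal J R by fact
  note Jc = J.Icarr
  show ?thesis
  proof (rule idealI[OF ring_axioms])
    show "subgroup ?I (add_monoid R)"
    proof (rule add.subgroupI)
      fix y assume "y \<in> ?I"
      then show "\<ominus> y \<in> ?I" using Jc by (simp add: l_minus P.a_inv_closed)
    next
      show "?I \<noteq> {}" using Jc P.zero_closed by (auto intro: exI[of _ \<zero>])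
    qed (use Jc in \<open>auto simp: l_distr P.a_closed\<close>)
  next
    fix y s assume y: "y \<in> ?I" and s: "s \<in> carrier R"
    show "s \<otimes> y \<in> ?I" using y s Jc by (simp add: m_assoc P.I_l_closed)
    show "y \<otimes> s \<in> ?I" using y s Jc by (simp add: m_assoc J.I_l_closed)
  qed
qed

text \<open>Passes from ideals to elements without computing with the ideals generated by
  \<open>a\<close> and \<open>b\<close>. The larger ideals \<open>J\<close>, of all \<open>x\<close>
  with \<open>a R x\<close> inside \<open>P\<close>, and \<open>I\<close>, of all \<open>y\<close>
  with \<open>y J\<close> inside \<open>P\<close>, have their product in \<open>P\<close> by
  construction.\<close>

lemma (in ring) two_sided_prime_idealD:
  assumes prime: "two_sided_prime_ideal P R"
    and a: "a \<in> carrier R" and b: "b \<in> carrier R"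
    and ab: "\<And>r. r \<in> carrier R \<Longrightarrow> a \<otimes> r \<otimes> b \<in> P"
  shows "a \<in> P \<or> b \<in> P"
proof -
  have P: "ideal P R" using prime by (simp add: two_sided_prime_ideal_def)
  interpret P: ideal P R by (fact P)
  define J where "J = {x \<in> carrier R. \<forall>r \<in> carrier R. a \<otimes> r \<otimes> x \<in> P}"
  define I where "I = {y \<in> carrier R. \<forall>x \<in> J. y \<otimes> x \<in> P}"
  have J: "ideal J R" unfolding J_def by (rule ideal_right_annihilator_mod[OF P a])
  have I: "ideal I R" unfolding I_def by (rule ideal_left_annihilator_mod[OF P J])
  \<comment> \<open>The product ideal is built inductively from products and sums: the products lie
    in \<open>P\<close> by the choice of \<open>I\<close>, and \<open>P\<close> is closed under
    sums.\<close>
  have "z \<in> P" if "z \<in> I \<cdot> J" for z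
    using that by induction (auto simp: I_def P.a_closed)
  then have "I \<subseteq> P \<or> J \<subseteq> P"
    using prime I J by (auto simp: two_sided_prime_ideal_def)
  moreover have "b \<in> J" using ab b by (simp add: J_def)
  \<comment> \<open>The instance \<open>r = \<one>\<close> of the condition defining
    \<open>J\<close> puts \<open>a \<otimes> x\<close> in \<open>P\<close>.\<close>
  moreover have "a \<in> I"
    using a by (force simp: I_def J_def dest: bspec[of _ _ \<one>])
  ultimately show ?thesis by blast
qed

lemma (in ring) P_symmetric_prod_zero:
  assumes "P_symmetric R"
    and "a \<in> carrier R" "b \<in> carrier R" "r \<in> carrier R" "a \<otimes> b = \<zero>"
  shows "a \<otimes> r \<otimes> b \<in> prime_radical R"
  using assms by (simp add: P_symmetric_def m_assoc)

theorem theorem2p3: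
  fixes R :: "('a, 'b) ring_scheme" (structure)
  assumes "ring R" and "P_symmetric R"
  shows "N2 R \<subseteq> prime_radical R \<and> P_semicommutative R"
proof
  interpret ring R by fact
  show "N2 R \<subseteq> prime_radical R"
  proof
    fix a assume "a \<in> N2 R"
    then have a: "a \<in> carrier R" and "a \<otimes> a = \<zero>"
      by (auto simp: N2_def numeral_2_eq_2)
    then have "a \<otimes> r \<otimes> a \<in> prime_radical R" if "r \<in> carrier R" for r
      using P_symmetric_prod_zero assms(2) that by blast
    \<comment> \<open>With \<open>a\<close> in both places, the two alternatives of the elementwise
      criterion coincide.\<close>
    then have "a \<in> P" if "two_sided_prime_ideal P R" for P
      using two_sided_prime_idealD[OF that a a] that by (auto simp: prime_radical_def)
    then show "a \<in> prime_radical R" using a by (simp add: prime_radical_def)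
  qed
  show "P_semicommutative R"
    using P_symmetric_prod_zero assms(2) by (auto simp: P_semicommutative_def)
qed

end
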